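(* For all integers $d,a_1,\ldots,a_d\geq 1$, the complete $d$-partite graph $K_{a_1,\ldots,a_d}$ is levelable.
   Context: The complete $d$-partite graph $K_{a_1,\ldots,a_d}$ has vertex set $\{x_{i,j} : 1\leq i\leq d,\ 1\leq j\leq a_i\}$ and edges $\{x_{i,j},x_{k,l}\}$ for all $1\leq i<k\leq d$ (and all $1\le j\le a_i$, $1\le l\le a_k$). A finite simple graph $G$ on $\{x_1,\ldots,x_n\}$ is levelable if there exist positive integers $c_1,\ldots,c_n$ (a weight $c_i$ for each vertex $x_i$) and a constant $c$ such that $\sum_{x_i\in W}c_i=c$ for every maximal (under inclusion) independent set $W$ of $G$. *)

theory Defs
  imports "Graph_Theory.Pair_Digraph"
begin

text \<open>Finite simple graphs are the \<^locale>\<open>pair_graph\<close>s of the AFP entry Graph_Theory: a finite vertex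
  set with a symmetric irreflexive arc relation, an edge \<open>{x, y}\<close> being the two arcs \<open>(x, y)\<close> and
  \<open>(y, x)\<close>.\<close>

definition independent_set :: "'a pair_pre_digraph \<Rightarrow> 'a set \<Rightarrow> bool" where
  "independent_set G W \<longleftrightarrow> W \<subseteq> pverts G \<and> (\<forall>x\<in>W. \<forall>y\<in>W. (x, y) \<notin> parcs G)"

definition maximal_independent_set :: "'a pair_pre_digraph \<Rightarrow> 'a set \<Rightarrow> bool" where
  "maximal_independent_set G W \<longleftrightarrow>
     independent_set G W \<and> (\<forall>W'. independent_set G W' \<and> W \<subseteq> W' \<longrightarrow> W' = W)"

definition levelable :: "'a pair_pre_digraph \<Rightarrow> bool" where
  "levelable G \<longleftrightarrow> pair_graph G \<and>
     (\<exists>(w :: 'a \<Rightarrow> nat) (c :: nat).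
        (\<forall>x\<in>pverts G. w x > 0) \<and>
        (\<forall>W. maximal_independent_set G W \<longrightarrow> (\<Sum>x\<in>W. w x) = c))"

text \<open>The vertex \<open>x\<^sub>i\<^sub>,\<^sub>j\<close> is the pair \<open>(i, j)\<close>. Only the values \<open>a 1, \<dots>, a d\<close> matter.\<close>

definition complete_multipartite :: "nat \<Rightarrow> (nat \<Rightarrow> nat) \<Rightarrow> (nat \<times> nat) pair_pre_digraph" where
  "complete_multipartite d a =
     (let E = {((i, j), (k, l)) | i j k l.
                 1 \<le> i \<and> i < k \<and> k \<le> d \<and> 1 \<le> j \<and> j \<le> a i \<and> 1 \<le> l \<and> l \<le> a k}
      in \<lparr> pverts = {(i, j) | i j. 1 \<le> i \<and> i \<le> d \<and> 1 \<le> j \<and> j \<le> a i},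
           parcs = E \<union> converse E \<rparr>)"

end

theory Submission
  imports Defs
begin

text \<open>The maximal independent sets are the parts \<open>{i} \<times> {1..a i}\<close>. With \<open>P = a 1 * \<dots> * a d\<close>, giving every
  vertex of the \<open>i\<close>-th part the weight \<open>P / a i\<close> makes every part weigh \<open>P\<close>.\<close>

lemma pverts_complete_multipartite:
  "pverts (complete_multipartite d a) = (SIGMA i:{1..d}. {1..a i})"
  by (auto simp: complete_multipartite_def Let_def)

text \<open>Joining the arcs with their converse turns the order \<open>i < k\<close> of the
  definition into \<open>i \<noteq> k\<close>, a form in which symmetry is evident.\<close>

lemma parcs_complete_multipartite:
  "((i, j), (k, l)) \<in> parcs (complete_multipartite d a) \<longleftrightarrow>
     i \<noteq> k \<and> i \<in> {1..d} \<and> k \<in> {1..d} \<and> j \<in> {1..a i} \<and> l \<in> {1..a k}"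
  by (auto simp: complete_multipartite_def Let_def)

lemma pair_graph_complete_multipartite: "pair_graph (complete_multipartite d a)"
proof
  let ?G = "complete_multipartite d a"
  show "finite (pverts ?G)"
    by (simp add: pverts_complete_multipartite)
  show "symmetric (with_proj ?G)"
    by (auto simp: symmetric_def sym_def parcs_complete_multipartite arcs_ends_conv)
  \<comment> \<open>Besides closing three of the goals, these facts place all arcs inside the finite
    set \<open>pverts ?G \<times> pverts ?G\<close>.\<close>
  have parcsD: "fst e \<in> pverts ?G" "snd e \<in> pverts ?G" "fst e \<noteq> snd e" if "e \<in> parcs ?G" for e
    using that
    by (cases e; auto simp: pverts_complete_multipartite parcs_complete_multipartite)+
  show "fst e \<in> pverts ?G" "snd e \<in> pverts ?G" "fst e \<noteq> snd e" if "e \<in> parcs ?G" for e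
    using that by (fact parcsD)+
  show "finite (parcs ?G)"
    by (rule finite_subset[of _ "pverts ?G \<times> pverts ?G"])
      (auto dest: parcsD simp: pverts_complete_multipartite)
qed

lemma independent_set_part:
  assumes "i \<in> {1..d}"
  shows "independent_set (complete_multipartite d a) ({i} \<times> {1..a i})"
  using assms
  by (auto simp: independent_set_def pverts_complete_multipartite parcs_complete_multipartite)

text \<open>Vertices of different parts are always adjacent, so one vertex of \<open>W\<close> fixes
  the part in which all others lie.\<close>

lemma independent_set_subset_part:
  assumes "independent_set (complete_multipartite d a) W" and "(i, j) \<in> W"
  shows "i \<in> {1..d} \<and> W \<subseteq> {i} \<times> {1..a i}"
  using assms
  by (fastforce simp: independent_set_def pverts_complete_multipartite parcs_complete_multipartite)

lemma maximal_independent_set_complete_multipartite: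
  assumes "d \<ge> 1" and "a 1 \<ge> 1"
    and max: "maximal_independent_set (complete_multipartite d a) W"
  obtains i where "i \<in> {1..d}" and "W = {i} \<times> {1..a i}"
proof -
  have indep: "independent_set (complete_multipartite d a) W"
    using max by (simp add: maximal_independent_set_def)
  have maxD: "W = {i} \<times> {1..a i}" if "i \<in> {1..d}" "W \<subseteq> {i} \<times> {1..a i}" for i
    using max independent_set_part[OF that(1), of a] that(2)
    unfolding maximal_independent_set_def by blast
  \<comment> \<open>The empty set lies in part 1, so maximality would make that part empty, against
    \<open>a 1 \<ge> 1\<close>.\<close>
  have "W \<noteq> {}"
    using maxD[of 1] assms(1,2) by (auto simp: eq_commute[of "{}"])
  then obtain i j where "(i, j) \<in> W"
    by auto
  with indep have "i \<in> {1..d}" "W \<subseteq> {i} \<times> {1..a i}"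
    using independent_set_subset_part by blast+
  then show thesis
    using maxD that by blast
qed

theorem corollary2p3:
  fixes d :: nat and a :: "nat \<Rightarrow> nat"
  assumes "d \<ge> 1"
    and "\<And>i. i \<in> {1..d} \<Longrightarrow> a i \<ge> 1"
  shows "levelable (complete_multipartite d a)"
proof -
  define P where "P = (\<Prod>k\<in>{1..d}. a k)"
  define w where "w = (\<lambda>x :: nat \<times> nat. P div a (fst x))"
  have "P > 0"
    unfolding P_def using assms(2) by (intro prod_pos) force
  have dvd: "a i dvd P" if "i \<in> {1..d}" for i
    unfolding P_def using that by (intro dvd_prodI) auto
  \<comment> \<open>A divisor of the positive number \<open>P\<close> is at most \<open>P\<close>,
    so the quotient does not round down to 0.\<close>
  have "w x > 0" if "x \<in> pverts (complete_multipartite d a)" for x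
    using that dvd[of "fst x"] assms(2)[of "fst x"] \<open>P > 0\<close>
    by (auto simp: w_def pverts_complete_multipartite div_greater_zero_iff dest: dvd_imp_le)
  moreover have "(\<Sum>x\<in>W. w x) = P"
    if max: "maximal_independent_set (complete_multipartite d a) W" for W
  proof -
    obtain i where i: "i \<in> {1..d}" and W: "W = {i} \<times> {1..a i}"
      using maximal_independent_set_complete_multipartite[OF assms(1) assms(2) max] assms(1) by auto
    have "(\<Sum>x\<in>W. w x) = (\<Sum>x\<in>W. P div a i)"
      by (intro sum.cong) (auto simp: W w_def)
    \<comment> \<open>The part has \<open>a i\<close> vertices of equal weight, and by divisibility
      \<open>a i * (P div a i)\<close> is exactly \<open>P\<close>.\<close>
    also have "\<dots> = P"
      using dvd[OF i] by (simp add: W card_cartesian_product_singleton)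
    finally show ?thesis .
  qed
  ultimately show ?thesis
    unfolding levelable_def using pair_graph_complete_multipartite by blast
qed

end
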